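(* Let $n \ge 931$ be an integer and $m$ an integer with $0\le m \le n/8$. Let $p(m,n)=\frac12+\frac{m}{2n}+\sqrt{\frac{1}{2n}\ln 6}$. Let $\mathbf{W}$ be distributed as $m+\mathrm{Bin}(n-m,\frac12)$ and $\mathbf{W}^+$ be distributed as $\mathrm{Bin}(n,p(m,n))$. Then for every set $\mathcal{W}\subseteq\{0,1,\dots,n\}$, \[ \Pr[\mathbf{W}^+\in\mathcal W]\le 51\cdot \Pr[\mathbf{W}\in\mathcal W]+\frac13 . \]
   Context: $\mathrm{Bin}(N,q)$ denotes the binomial distribution with $N$ trials and success probability $q$; $m+\mathrm{Bin}(n-m,\frac12)$ denotes the distribution of $m$ plus a $\mathrm{Bin}(n-m,\frac12)$ random variable. *)

theory Defs
  imports "HOL-Probability.Probability"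
begin

definition p_mn :: "nat \<Rightarrow> nat \<Rightarrow> real" where
  "p_mn m n = 1/2 + real m / (2 * real n) + sqrt (ln 6 / (2 * real n))"

end

theory Submission
  imports Defs
begin

text \<open>
  If \<open>h k \<ge> 1 - 51 \<cdot> Pr[W = k] / Pr[W\<^sup>+ = k]\<close> for all \<open>k\<close>, then
  \<open>Pr[W\<^sup>+ \<in> S] - 51 \<cdot> Pr[W \<in> S]\<close> is at most the expectation of \<open>h(W\<^sup>+)\<close>. Bounding the logarithm
  of the binomial quotient in \<open>Pr[W\<^sup>+ = k] / Pr[W = k]\<close> by an integral gives a convex function
  of \<open>k\<close> whose value at the mean \<open>n p\<close> is about \<open>(n / (n - m)) ln 6\<close> and whose slope slightly above
  the mean is at most \<open>4.9 / \<surd>n\<close>. By the elementary inequality \<open>1 - 1/u \<le> c \<surd>u\<close>, where the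
  best constant is \<open>c = 2 / (3 \<surd>3)\<close>, the exponential
  \<open>h k = 0.152 exp (2.45 (k - n p) / \<surd>n)\<close> is then a majorant for all \<open>k\<close> that are not
  more than \<open>2 \<surd>n\<close> below the mean. Hoeffding's lemma bounds its expectation by \<open>0.152 exp 0.7504\<close>,
  and Hoeffding's inequality bounds the remaining lower tail by \<open>exp (-8)\<close>.
\<close>

section \<open>Likelihood ratio and its integral bound\<close>

text \<open>
  An upper bound for \<open>ln (Pr[W\<^sup>+ = x] / Pr[W = x])\<close>: the sum \<open>\<Sum>i<m. ln ((n - i) / (x - i))\<close> coming
  from the binomial coefficients is replaced by the integral over \<open>[0, m]\<close>.
\<close>

definition log_ratio :: "real \<Rightarrow> real \<Rightarrow> real \<Rightarrow> real \<Rightarrow> real" where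
  "log_ratio n m p x = n * ln n - (n - m) * ln (n - m) + (x - m) * ln (x - m) - x * ln x
     + x * ln p + (n - x) * ln (1 - p) + (n - m) * ln 2"

text \<open>The right side is the integral of \<open>ln ((a - x) / (b - x))\<close> over [0, 1], and
  this integrand is smallest at 0 because \<open>b \<le> a\<close>. Applying the mean value theorem
  to the antiderivative \<open>H\<close> avoids integration.\<close>

lemma ln_ratio_le_integral:
  fixes a b :: real
  assumes "1 < b" "b \<le> a"
  shows "ln (a / b) \<le> a * ln a - (a - 1) * ln (a - 1) + (b - 1) * ln (b - 1) - b * ln b"
proof -
  define H where "H = (\<lambda>x. (b - x) * ln (b - x) - (a - x) * ln (a - x))"
  have D: "(H has_real_derivative (ln (a - x) - ln (b - x))) (at x)" if "0 \<le> x" "x \<le> 1" for x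
    unfolding H_def using assms that
    by (auto intro!: derivative_eq_intros)
  obtain z where z: "0 < z" "z < 1" "H 1 - H 0 = (1 - 0) * (ln (a - z) - ln (b - z))"
    using MVT2[of 0 1 H "\<lambda>x. ln (a - x) - ln (b - x)"] D by auto
  have "a / b \<le> (a - z) / (b - z)"
    using assms z(1,2) by (simp add: field_simps mult_right_mono)
  then have "ln (a / b) \<le> ln ((a - z) / (b - z))"
    using assms z(1,2) by simp
  also have "\<dots> = ln (a - z) - ln (b - z)"
    using assms z(1,2) by (simp add: ln_div)
  also have "\<dots> = H 1 - H 0"
    using z(3) by simp
  finally show ?thesis
    by (simp add: H_def)
qed

text \<open>Each induction step splits off one factor \<open>(n - m) / (k - m)\<close> of the
  binomial quotient, and the integral bounds for the unit intervals telescope.\<close>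

lemma binomial_shift_le:
  assumes "m < k" "k \<le> n"
  shows "real (n choose k) \<le> real ((n - m) choose (k - m)) *
    exp (real n * ln (real n) - (real n - real m) * ln (real n - real m)
       + (real k - real m) * ln (real k - real m) - real k * ln (real k))"
  using assms(1)
proof (induction m)
  case 0
  then show ?case by simp
next
  case (Suc m)
  define a b where "a = real n - real m" and "b = real k - real m"
  have b: "1 < b" "b \<le> a"
    using Suc.prems assms(2) by (auto simp: a_def b_def)
  have "(k - m) * ((n - m) choose (k - m)) = (n - m) * ((n - m - 1) choose (k - m - 1))"
    by (rule times_binomial_minus1_eq) (use Suc.prems in simp)
  then have "real ((k - m) * ((n - m) choose (k - m))) = real ((n - m) * ((n - m - 1) choose (k - m - 1)))"
    by (rule arg_cong)
  then have "b * real ((n - m) choose (k - m)) = a * real ((n - Suc m) choose (k - Suc m))"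
    using Suc.prems assms(2) by (simp add: a_def b_def of_nat_diff)
  then have "real ((n - m) choose (k - m)) = real ((n - Suc m) choose (k - Suc m)) * (a / b)"
    using b by (simp add: field_simps)
  also have "\<dots> = real ((n - Suc m) choose (k - Suc m)) * exp (ln (a / b))"
    using b by simp
  also have "\<dots> \<le> real ((n - Suc m) choose (k - Suc m)) *
      exp (a * ln a - (a - 1) * ln (a - 1) + (b - 1) * ln (b - 1) - b * ln b)"
    using ln_ratio_le_integral[OF b] by (intro mult_left_mono) auto
  finally have step: "real ((n - m) choose (k - m)) \<le> \<dots>" .
  have "real (n choose k) \<le> real ((n - m) choose (k - m)) *
      exp (real n * ln (real n) - a * ln a + b * ln b - real k * ln (real k))"
    using Suc by (simp add: a_def b_def)
  also have "\<dots> \<le> real ((n - Suc m) choose (k - Suc m)) *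
      exp (a * ln a - (a - 1) * ln (a - 1) + (b - 1) * ln (b - 1) - b * ln b) *
      exp (real n * ln (real n) - a * ln a + b * ln b - real k * ln (real k))"
    by (intro mult_right_mono step) auto
  also have "\<dots> = real ((n - Suc m) choose (k - Suc m)) *
    exp (real n * ln (real n) - (a - 1) * ln (a - 1) + (b - 1) * ln (b - 1) - real k * ln (real k))"
    by (simp add: mult.assoc flip: exp_add)
  finally show ?case
    by (simp add: a_def b_def diff_diff_eq add.commute)
qed

lemma pmf_binomial_le_shifted:
  assumes "m < k" "k \<le> n" "0 < p" "p < 1"
  shows "pmf (binomial_pmf n p) k
    \<le> pmf (map_pmf (\<lambda>k. m + k) (binomial_pmf (n - m) (1/2))) k * exp (log_ratio n m p k)"
proof -
  let ?E = "real n * ln (real n) - (real n - real m) * ln (real n - real m)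
       + (real k - real m) * ln (real k - real m) - real k * ln (real k)"
  have "pmf (map_pmf (\<lambda>k. m + k) (binomial_pmf (n - m) (1/2))) (m + (k - m))
      = pmf (binomial_pmf (n - m) (1/2)) (k - m)"
    by (rule pmf_map_inj') (auto simp: inj_def)
  also have "\<dots> = real ((n - m) choose (k - m)) * (1/2) ^ (n - m)"
    using assms by (simp flip: power_add)
  finally have W: "pmf (map_pmf (\<lambda>k. m + k) (binomial_pmf (n - m) (1/2))) k
      = real ((n - m) choose (k - m)) * (1/2) ^ (n - m)"
    using assms by simp
  have "pmf (binomial_pmf n p) k = real (n choose k) * (p ^ k * (1 - p) ^ (n - k))"
    using assms by simp
  also have "\<dots> \<le> real ((n - m) choose (k - m)) * exp ?E * (p ^ k * (1 - p) ^ (n - k))"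
    using assms by (intro mult_right_mono binomial_shift_le) auto
  also have "p ^ k = exp (real k * ln p)"
    using assms by (simp add: exp_of_nat_mult)
  also have "(1 - p) ^ (n - k) = exp ((real n - real k) * ln (1 - p))"
    using assms exp_of_nat_mult[of "n - k" "ln (1 - p)"] by (simp add: of_nat_diff)
  also have "real ((n - m) choose (k - m)) * exp ?E *
      (exp (real k * ln p) * exp ((real n - real k) * ln (1 - p)))
    = real ((n - m) choose (k - m)) * (1/2) ^ (n - m) * exp (log_ratio n m p k)"
  proof -
    have "(1/2::real) ^ (n - m) = exp (- ((real n - real m) * ln 2))"
      using assms exp_of_nat_mult[of "n - m" "- ln (2::real)"]
      by (simp add: of_nat_diff exp_minus inverse_eq_divide)
    then show ?thesis
      by (simp add: log_ratio_def mult.assoc flip: exp_add)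
  qed
  finally show ?thesis
    by (simp only: W)
qed

text \<open>The additive constants from the product rule cancel. For \<open>0 < p < 1\<close> the
  slope is the logarithm of \<open>(x - m) * p / (x * (1 - p))\<close>, so its sign is decided by a
  linear inequality in \<open>x\<close>.\<close>

lemma log_ratio_deriv:
  assumes "m < x" "0 < x"
  shows "(log_ratio n m p has_real_derivative (ln (x - m) - ln x + ln p - ln (1 - p))) (at x)"
  unfolding log_ratio_def[abs_def] using assms
  by (auto intro!: derivative_eq_intros)

section \<open>Value of \<open>log_ratio\<close> at the mean\<close>

text \<open>The gap has derivative \<open>x ^ 3 / (1 + x)\<close>, which has the sign of
  \<open>x\<close>, so the gap is smallest at 0.\<close>

lemma ln_le_cubic:
  fixes v :: real
  assumes "-1 < v"
  shows "ln (1 + v) \<le> v - v\<^sup>2 / 2 + v ^ 3 / 3"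
proof -
  define f where "f = (\<lambda>x::real. x - x\<^sup>2 / 2 + x ^ 3 / 3 - ln (1 + x))"
  have D: "(f has_real_derivative (x ^ 3 / (1 + x))) (at x)" if "-1 < x" for x
    unfolding f_def using that
    by (auto intro!: derivative_eq_intros simp: field_simps power2_eq_square power3_eq_cube)
  have "f 0 \<le> f v"
  proof (cases "0 \<le> v")
    case True
    show ?thesis
      by (rule DERIV_nonneg_imp_nondecreasing[OF True]) (use D in \<open>force intro!: exI\<close>)
  next
    case False
    show ?thesis
    proof (rule DERIV_nonpos_imp_nonincreasing[of v 0])
      fix x assume "v \<le> x" "x \<le> 0"
      then have "x ^ 3 / (1 + x) \<le> 0"
        using assms by (intro divide_nonpos_pos) (auto simp: power3_eq_cube mult_nonneg_nonpos mult_nonpos_nonpos)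
      then show "\<exists>y. (f has_real_derivative y) (at x) \<and> y \<le> 0"
        using D[of x] assms \<open>v \<le> x\<close> by auto
    qed (use False in simp)
  qed
  then show ?thesis by (simp add: f_def)
qed

text \<open>When the cubic bound is used at \<open>v\<close> and at \<open>- v\<close>, all odd
  powers cancel.\<close>

lemma entropy_le:
  fixes v :: real
  assumes "\<bar>v\<bar> < 1"
  shows "(1 + v) * ln (1 + v) + (1 - v) * ln (1 - v) \<le> v\<^sup>2 + 2 * v ^ 4 / 3"
proof -
  have "(1 + v) * ln (1 + v) + (1 - v) * ln (1 - v)
    \<le> (1 + v) * (v - v\<^sup>2 / 2 + v ^ 3 / 3) + (1 - v) * (- v - (- v)\<^sup>2 / 2 + (- v) ^ 3 / 3)"
    using assms ln_le_cubic[of v] ln_le_cubic[of "- v"] by (intro add_mono mult_left_mono) auto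
  also have "\<dots> = v\<^sup>2 + 2 * v ^ 4 / 3"
    by (simp add: field_simps power2_eq_square power3_eq_cube power4_eq_xxxx)
  finally show ?thesis .
qed

lemma ln6_upper: "ln (6::real) \<le> 1793/1000"
proof -
  \<comment> \<open>Splitting the exponent into 32 parts makes the quadratic Taylor bound sharp
    enough; \<open>ln 6\<close> is about 1.7918.\<close>
  have "(6::real) \<le> (1 + 1793/32000 + (1793/32000)\<^sup>2 / 2) ^ 32"
    by (simp add: power2_eq_square power_divide divide_simps)
  also have "\<dots> \<le> exp (1793/32000) ^ 32"
    by (intro power_mono exp_lower_Taylor_quadratic) auto
  also have "\<dots> = exp (1793/1000)"
    by (simp flip: exp_of_nat_mult)
  finally show ?thesis
    by (metis ln_le_cancel_iff ln_exp exp_gt_zero zero_less_numeral)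
qed


text \<open>With \<open>N = n - m\<close>, the numbers \<open>n * p - m\<close> and
  \<open>n * (1 - p)\<close> are \<open>N * (1 + v) / 2\<close> and \<open>N * (1 - v) / 2\<close>.
  All other logarithms cancel and an entropy term in \<open>v\<close> remains, with leading part
  \<open>N * v\<^sup>2 / 2 = (n / N) * ln 6\<close>.\<close>

lemma log_ratio_mean_le:
  fixes n m e p :: real
  assumes n: "931 \<le> n" and m: "0 \<le> m" "8 * m \<le> n" and e: "0 < e" "2 * n * e\<^sup>2 = ln 6"
    and p: "p = 1/2 + m / (2 * n) + e" "p < 1"
  shows "log_ratio n m p (n * p) \<le> 206/100"
proof -
  define N where "N = n - m"
  define v where "v = 2 * n * e / N"
  have N: "7/8 * n \<le> N" "0 < N"
    using n m by (auto simp: N_def)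
  have v0: "0 < v"
    using n N e by (simp add: v_def)
  have up: "n * p - m = N * (1 + v) / 2"
    using n N by (simp add: p v_def N_def field_simps)
  have dn: "n * (1 - p) = N * (1 - v) / 2"
    using n N by (simp add: p v_def N_def field_simps)
  have "0 < n * (1 - p)"
    using n p by simp
  then have v1: "v < 1"
    using N by (simp add: dn zero_less_mult_iff)
  have p0: "0 < p"
    using n m e by (simp add: p add_pos_nonneg)
  have lnp: "ln (n * p) = ln n + ln p" "ln (n * (1 - p)) = ln n + ln (1 - p)"
    using n p p0 by (simp_all add: ln_mult)
  have lnv: "ln (N * (1 + v) / 2) = ln N + ln (1 + v) - ln 2"
            "ln (N * (1 - v) / 2) = ln N + ln (1 - v) - ln 2"
    using N v0 v1 by (simp_all add: ln_mult ln_div)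
  have "log_ratio n m p (n * p) = - N * ln N + (n * p - m) * ln (n * p - m)
      + n * (1 - p) * ln (n * (1 - p)) + N * ln 2"
    unfolding log_ratio_def lnp N_def by (simp add: algebra_simps)
  also have "\<dots> = N / 2 * ((1 + v) * ln (1 + v) + (1 - v) * ln (1 - v))"
    unfolding up dn lnv by (simp add: field_simps)
  also have "\<dots> \<le> N / 2 * (v\<^sup>2 + 2 * v ^ 4 / 3)"
    using N v0 v1 by (intro mult_left_mono entropy_le) auto
  also have "\<dots> = (N * v\<^sup>2) / 2 + (N * v\<^sup>2)\<^sup>2 / (3 * N)"
    using N by (simp add: field_simps power2_eq_square power4_eq_xxxx)
  \<comment> \<open>From \<open>8 * m \<le> n\<close> follows \<open>n / N \<le> 8/7\<close>, which
    gives 4.1 as a bound for \<open>N * v\<^sup>2\<close>; 814 lies just below 7/8 * 931.\<close>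
  also have "\<dots> \<le> 41/20 + (41/10)\<^sup>2 / (3 * 814)"
  proof -
    have "N * v\<^sup>2 = 2 * (2 * n * e\<^sup>2) * n / N"
      using N by (simp add: v_def field_simps power2_eq_square)
    also have "\<dots> = 2 * ln 6 * (n / N)"
      by (simp add: e)
    also have "\<dots> \<le> 2 * (1793/1000) * (8/7)"
      using N n ln6_upper by (intro mult_mono) (auto simp: field_simps)
    also have "\<dots> \<le> 41/10"
      by simp
    finally have "N * v\<^sup>2 \<le> 41/10" .
    moreover from this have "(N * v\<^sup>2)\<^sup>2 / (3 * N) \<le> (41/10)\<^sup>2 / (3 * 814)"
      using N n by (intro frac_le power_mono) auto
    ultimately show ?thesis
      by simp
  qed
  also have "\<dots> \<le> 206/100"
    by (simp add: power2_eq_square)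
  finally show ?thesis .
qed

section \<open>Slope of \<open>log_ratio\<close> around the mean\<close>

text \<open>With x = exp t this is t \<le> sinh t. It is exact to second order at 1; the bound
  \<open>x - 1\<close> would be too coarse for the slope constant 4.9.\<close>

lemma ln_le_half_diff_inverse:
  fixes x :: real
  assumes "1 \<le> x"
  shows "ln x \<le> (x - 1 / x) / 2"
proof -
  define f where "f = (\<lambda>x::real. (x - 1 / x) / 2 - ln x)"
  have "f 1 \<le> f x"
  proof (rule DERIV_nonneg_imp_nondecreasing[OF assms])
    fix y :: real assume "1 \<le> y"
    then have "(f has_real_derivative (1 - 1 / y)\<^sup>2 / 2) (at y)"
      unfolding f_def
      by (auto intro!: derivative_eq_intros simp: field_simps power2_eq_square)
    then show "\<exists>z. (f has_real_derivative z) (at y) \<and> 0 \<le> z"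
      by (intro exI[of _ "(1 - 1 / y)\<^sup>2 / 2"]) simp
  qed
  then show ?thesis by (simp add: f_def)
qed

text \<open>For A = 1 - m/n, B = 1 + m/n, s = 1 / sqrt n and \<alpha> = 2 e sqrt n, the left side is
  the slope of \<open>log_ratio\<close> at n p + 0.8 sqrt n. The terms with \<open>A\<close>
  contribute at most 6.17 s, and those with \<open>B\<close> take back at least 1.29 s.\<close>

lemma slope_le:
  fixes A B \<alpha> s :: real
  assumes A: "7/8 \<le> A" and B: "0 < B" "B \<le> 9/8" and \<alpha>: "0 \<le> \<alpha>" "\<alpha> \<le> 1894/1000"
    and s: "0 < s" "s \<le> 328/10000"
  shows "ln (A + (\<alpha> + 16/10) * s) - ln (B + (\<alpha> + 16/10) * s) + ln (B + \<alpha> * s) - ln (A - \<alpha> * s)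
    \<le> 49/10 * s"
proof -
  \<comment> \<open>These are the denominator and the numerator of the quotient in the worst case
    \<open>A = 7/8\<close>, \<open>\<alpha> = 1894/1000\<close>.\<close>
  define a b where "a = 7/8 - 1894/1000 * s" and "b = 7/8 + 3494/1000 * s"
  have as: "0 \<le> \<alpha> * s" "\<alpha> * s \<le> 1894/1000 * s"
    using \<alpha> s by (auto intro: mult_right_mono)
  have ab: "0 < a" "0 < b"
    using s by (auto simp: a_def b_def)
  have num: "0 < A + (\<alpha> + 16/10) * s"
    using A \<alpha> s by (simp add: add_pos_nonneg)
  have den: "0 < A - \<alpha> * s"
    using A as s by linarith
  have "A + (\<alpha> + 16/10) * s = (A - \<alpha> * s) + (2 * (\<alpha> * s) + 16/10 * s)"
    by (simp add: algebra_simps)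
  then have "(A + (\<alpha> + 16/10) * s) / (A - \<alpha> * s) = 1 + (2 * (\<alpha> * s) + 16/10 * s) / (A - \<alpha> * s)"
    using den by (simp only: add_divide_distrib[of "A - \<alpha> * s"]) simp
  also have "\<dots> \<le> 1 + (2 * (1894/1000 * s) + 16/10 * s) / a"
    using A as s ab(1) unfolding a_def by (intro add_mono frac_le order_refl) linarith+
  also have "\<dots> = (a + (2 * (1894/1000 * s) + 16/10 * s)) / a"
    using ab(1) by (simp add: add_divide_distrib)
  also have "a + (2 * (1894/1000 * s) + 16/10 * s) = b"
    by (simp add: a_def b_def)
  finally have "ln ((A + (\<alpha> + 16/10) * s) / (A - \<alpha> * s)) \<le> ln (b / a)"
    using A num den ab by (subst ln_le_cancel_iff) (auto intro!: divide_pos_pos)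
  also have "\<dots> \<le> (b / a - a / b) / 2"
    using ln_le_half_diff_inverse[of "b / a"] ab s by (simp add: a_def b_def)
  also have "\<dots> = (b - a) * ((a + b) / (a * b)) / 2"
    using ab by (simp add: field_simps power2_eq_square)
  also have "\<dots> \<le> (b - a) * (229/100) / 2"
  proof -
    \<comment> \<open>At \<open>s = 0\<close> the quotient \<open>(a + b) / (a * b)\<close> is 16/7,
      just below 2.29. Replacing \<open>s * s\<close> by a multiple of \<open>s\<close> makes the
      remaining check linear.\<close>
    define t where "t = s * s"
    have t: "t \<le> 328/10000 * s"
      unfolding t_def using s by (intro mult_right_mono) auto
    have "229/100 * (a * b) - (a + b) = 21/6400 + s * 803/500 - t * 378859661/25000000"
      by (simp add: a_def b_def t_def algebra_simps)
    also have "\<dots> \<ge> 0"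
      using t s by simp
    finally have "a + b \<le> 229/100 * (a * b)"
      by simp
    then have "(a + b) / (a * b) \<le> 229/100"
      using ab by (simp add: divide_le_eq)
    then show ?thesis
      using s by (intro divide_right_mono mult_left_mono) (auto simp: a_def b_def)
  qed
  also have "\<dots> = 616926/100000 * s"
    by (simp add: a_def b_def)
  finally have 1: "ln (A + (\<alpha> + 16/10) * s) - ln (A - \<alpha> * s) \<le> 616926/100000 * s"
    using num den by (simp add: ln_div)
  have Bs: "0 < B + (\<alpha> + 16/10) * s" "B + (\<alpha> + 16/10) * s \<le> 124/100" "0 < B + \<alpha> * s"
    unfolding distrib_right using B as s by linarith+
  have "ln ((B + \<alpha> * s) / (B + (\<alpha> + 16/10) * s)) \<le> (B + \<alpha> * s) / (B + (\<alpha> + 16/10) * s) - 1"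
    using Bs by (intro ln_le_minus_one divide_pos_pos)
  also have "\<dots> = - (16/10 * s / (B + (\<alpha> + 16/10) * s))"
    using B as s by (simp add: field_simps)
  also have "\<dots> \<le> - (16/10 * s / (124/100))"
    using Bs s by (intro le_imp_neg_le frac_le) auto
  finally have 2: "ln (B + \<alpha> * s) - ln (B + (\<alpha> + 16/10) * s) \<le> - (16/10 * s / (124/100))"
    using Bs by (simp add: ln_div)
  from 1 2 s show ?thesis by simp
qed

text \<open>The product \<open>e * sqrt n\<close> is the constant sqrt (ln 6 / 2), about 0.9465, and
  30.5 squared is 930.25.\<close>

lemma scaled_deviation_bounds:
  fixes n e :: real
  assumes n: "931 \<le> n" and e: "0 < e" "2 * n * e\<^sup>2 = ln 6"
  shows "305/10 \<le> sqrt n" "7/10 \<le> e * sqrt n" "e * sqrt n \<le> 947/1000"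
proof -
  show "305/10 \<le> sqrt n"
    using n by (intro real_le_rsqrt) (simp add: power2_eq_square)
  have g: "(e * sqrt n)\<^sup>2 = ln 6 / 2"
    using n e by (simp add: power_mult_distrib field_simps)
  have "1 \<le> ln (6::real)"
    using exp_le by (simp add: ln_ge_iff)
  then have "(7/10)\<^sup>2 \<le> (e * sqrt n)\<^sup>2"
    unfolding g by (simp add: power2_eq_square)
  then show "7/10 \<le> e * sqrt n"
    by (rule power2_le_imp_le) (use n e in auto)
  have "(e * sqrt n)\<^sup>2 \<le> (947/1000)\<^sup>2"
    unfolding g using ln6_upper by (simp add: power2_eq_square)
  then show "e * sqrt n \<le> 947/1000"
    by (rule power2_le_imp_le) auto
qed

text \<open>The slope at \<open>y\<close> is nonnegative iff
  \<open>m * p \<le> y * (2 * p - 1)\<close>. As \<open>p > 1/2\<close>, it suffices to check this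
  at the left end n p - 2 sqrt n.\<close>

lemma log_ratio_mono_below_mean:
  fixes n m e p x :: real
  assumes n: "931 \<le> n" and m: "0 \<le> m" "8 * m \<le> n" and e: "0 < e" "2 * n * e\<^sup>2 = ln 6"
    and p: "p = 1/2 + m / (2 * n) + e" "p < 1"
    and x: "n * p - 2 * sqrt n \<le> x" "x \<le> n * p"
  shows "m < x" "log_ratio n m p x \<le> log_ratio n m p (n * p)"
proof -
  define r where "r = sqrt n"
  define g where "g = e * r"
  have r: "305/10 \<le> r" and g: "7/10 \<le> g" "g \<le> 947/1000"
    using scaled_deviation_bounds[OF n e] by (simp_all add: r_def g_def)
  have n_eq: "n = r * r"
    using n by (simp add: r_def)
  have mn: "0 \<le> m / n" "m / n \<le> 1/8"
    using n m by (auto simp: field_simps)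
  have p_half: "1/2 < p"
    using p mn e by simp
  have "r * (305/10) \<le> r * r"
    using r by simp
  moreover have "n * (1/2) < n * p"
    using p_half n by simp
  ultimately show mx: "m < x"
    using x(1) m(2) r unfolding r_def[symmetric] n_eq[symmetric] by linarith
  show "log_ratio n m p x \<le> log_ratio n m p (n * p)"
  proof (rule DERIV_nonneg_imp_nondecreasing[OF x(2)])
    fix y assume y: "x \<le> y" "y \<le> n * p"
    \<comment> \<open>The left side of the resulting inequality is at most 1/4 + 0.125, well below
      the lower bound 0.7 for \<open>g\<close>.\<close>
    have "4 * e = 4 * g / r"
      using r by (simp add: g_def)
    also have "\<dots> \<le> 4 * (947/1000) / (305/10)"
      using r g by (intro frac_le) auto
    finally have "2 * (m / n) + 4 * e \<le> 2 * g * (1/2)"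
      using mn g by simp
    also have "\<dots> \<le> 2 * g * p"
      using g p_half by (intro mult_left_mono) auto
    finally have "r * (2 * (m / n) + 4 * e) \<le> r * (2 * g * p)"
      using r by (intro mult_left_mono) auto
    also have "\<dots> = 2 * n * p * e"
      by (simp add: g_def n_eq)
    finally have "m * p \<le> (n * p - 2 * r) * (m / n + 2 * e)"
      using n by (simp add: algebra_simps)
    also have "m / n + 2 * e = 2 * p - 1"
      by (simp add: p)
    also have "(n * p - 2 * r) * (2 * p - 1) \<le> y * (2 * p - 1)"
      using x y p_half by (intro mult_right_mono) (auto simp: r_def)
    finally have "y * (1 - p) \<le> (y - m) * p"
      by (simp add: algebra_simps)
    then have "ln (y * (1 - p)) \<le> ln ((y - m) * p)"
      using mx y m p p_half by (subst ln_le_cancel_iff) auto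
    then have "0 \<le> ln (y - m) - ln y + ln p - ln (1 - p)"
      using mx y m p p_half by (simp add: ln_mult)
    then show "\<exists>z. (log_ratio n m p has_real_derivative z) (at y) \<and> 0 \<le> z"
      using log_ratio_deriv[of m y n p] mx y m by (intro exI conjI[rotated]) auto
  qed
qed

text \<open>The slope increases with \<open>y\<close>, so on the whole interval it is bounded by its
  value at the right end \<open>X\<close>, which \<open>slope_le\<close> estimates.\<close>

lemma log_ratio_above_mean:
  fixes n m e p x :: real
  assumes n: "931 \<le> n" and m: "0 \<le> m" "8 * m \<le> n" and e: "0 < e" "2 * n * e\<^sup>2 = ln 6"
    and p: "p = 1/2 + m / (2 * n) + e" "p < 1"
    and x: "n * p \<le> x" "x \<le> n * p + 8/10 * sqrt n"
  shows "log_ratio n m p x \<le> log_ratio n m p (n * p) + 49/10 * (x - n * p) / sqrt n"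
proof -
  define s where "s = 1 / sqrt n"
  define \<alpha> where "\<alpha> = 2 * (e * sqrt n)"
  have r: "305/10 \<le> sqrt n" and g: "7/10 \<le> e * sqrt n" "e * sqrt n \<le> 947/1000"
    using scaled_deviation_bounds[OF n e] by simp_all
  have s: "0 < s" "s \<le> 328/10000"
    using r n frac_le[of 1 1 "305/10" "sqrt n"] by (auto simp: s_def)
  have \<alpha>: "0 \<le> \<alpha>" "\<alpha> \<le> 1894/1000" and \<alpha>s: "\<alpha> * s = 2 * e"
    using g r by (auto simp: \<alpha>_def s_def)
  define A B where "A = 1 - m / n" and "B = 1 + m / n"
  have AB: "7/8 \<le> A" "0 < B" "B \<le> 9/8"
    using n m by (auto simp: A_def B_def field_simps)
  have p_eq: "p = (B + \<alpha> * s) / 2" "1 - p = (A - \<alpha> * s) / 2"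
    by (simp_all add: p(1) \<alpha>s A_def B_def field_simps)
  define X where "X = n * p + 8/10 * sqrt n"
  have ns: "n * s = sqrt n"
    using n by (simp add: s_def real_div_sqrt)
  have X_eq: "X = n / 2 * (B + (\<alpha> + 16/10) * s)"
    unfolding X_def p_eq ns[symmetric] by (simp add: algebra_simps)
  have Xm_eq: "X - m = n / 2 * (A + (\<alpha> + 16/10) * s)"
    unfolding X_eq using n by (simp add: A_def B_def field_simps)
  have pos: "0 < A + (\<alpha> + 16/10) * s" "0 < B + (\<alpha> + 16/10) * s" "0 < B + \<alpha> * s"
    using AB \<alpha> s by (auto intro!: add_pos_nonneg)
  have pos': "0 < A - \<alpha> * s"
    using p p_eq by simp
  have m_less: "m < n * p"
  proof -
    have "0 \<le> m / (2 * n)"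
      using n m by simp
    then have "n * (1/2) < n * p"
      using n e by (intro mult_strict_left_mono) (auto simp: p(1))
    then show ?thesis using n m by linarith
  qed
  have slope: "ln (y - m) - ln y + ln p - ln (1 - p) \<le> 49/10 * s"
    if y: "n * p \<le> y" "y \<le> X" for y
  proof -
    have my: "m < y" using m_less y by simp
    have "(y - m) / y \<le> (X - m) / X"
      using my y m mult_left_mono[of y X m] by (simp add: field_simps)
    then have "ln ((y - m) / y) \<le> ln ((X - m) / X)"
      using my y m by (subst ln_le_cancel_iff) auto
    then have "ln (y - m) - ln y \<le> ln (X - m) - ln X"
      using my y m by (simp add: ln_div)
    also have "\<dots> = ln (A + (\<alpha> + 16/10) * s) - ln (B + (\<alpha> + 16/10) * s)"
      unfolding Xm_eq unfolding X_eq using pos n by (simp add: ln_mult ln_div)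
    finally have "ln (y - m) - ln y + ln p - ln (1 - p) \<le>
        ln (A + (\<alpha> + 16/10) * s) - ln (B + (\<alpha> + 16/10) * s) + ln (B + \<alpha> * s) - ln (A - \<alpha> * s)"
      unfolding p_eq(2) unfolding p_eq(1) using pos pos' by (simp add: ln_div)
    also have "\<dots> \<le> 49/10 * s"
      by (rule slope_le) (use AB \<alpha> s in auto)
    finally show ?thesis .
  qed
  have "log_ratio n m p x - 49/10 * s * x \<le> log_ratio n m p (n * p) - 49/10 * s * (n * p)"
  proof (rule DERIV_nonpos_imp_nonincreasing[OF x(1)])
    fix y assume y: "n * p \<le> y" "y \<le> x"
    have "((\<lambda>x. log_ratio n m p x - 49/10 * s * x) has_real_derivative
        (ln (y - m) - ln y + ln p - ln (1 - p)) - 49/10 * s) (at y)"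
      using m_less m y by (auto intro!: derivative_eq_intros log_ratio_deriv)
    then show "\<exists>z. ((\<lambda>x. log_ratio n m p x - 49/10 * s * x) has_real_derivative z) (at y) \<and> z \<le> 0"
      using slope[of y] y x by (intro exI conjI) (assumption, auto simp: X_def)
  qed
  then show ?thesis
    by (simp add: s_def diff_divide_distrib algebra_simps)
qed

section \<open>Exponential moment of the binomial distribution\<close>

text \<open>By the binomial theorem the moment is the \<open>n\<close>-th power of that of one
  centred Bernoulli variable, to which Hoeffding's lemma applies.\<close>

lemma binomial_mgf_le:
  fixes p l :: real
  assumes "0 \<le> p" "p \<le> 1" "0 \<le> l"
  shows "measure_pmf.expectation (binomial_pmf n p) (\<lambda>k. exp (l * (real k - n * p)))
    \<le> exp (n * l\<^sup>2 / 8)"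
proof -
  have pos: "0 < 1 + p * (exp l - 1)"
    using assms by (intro add_pos_nonneg mult_nonneg_nonneg) auto
  have "measure_pmf.expectation (binomial_pmf n p) (\<lambda>k. exp (l * (real k - n * p)))
    = (\<Sum>k\<le>n. real (n choose k) * p ^ k * (1 - p) ^ (n - k) * exp (l * (real k - n * p)))"
    using assms by (subst expectation_binomial_pmf') auto
  also have "\<dots> = exp (- l * p) ^ n * (\<Sum>k\<le>n. real (n choose k) * (p * exp l) ^ k * (1 - p) ^ (n - k))"
    unfolding sum_distrib_left
    by (intro sum.cong refl)
       (simp add: power_mult_distrib right_diff_distrib exp_diff exp_minus field_simps flip: exp_of_nat_mult)
  also have "\<dots> = (exp (- l * p) * (1 + p * (exp l - 1))) ^ n"
  proof -
    have "1 + p * (exp l - 1) = p * exp l + (1 - p)"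
      by (simp add: algebra_simps)
    then show ?thesis
      by (simp only: power_mult_distrib binomial_ring)
  qed
  also have "exp (- l * p) * (1 + p * (exp l - 1)) = exp (- l * p + ln (1 + p * (exp l - 1)))"
    by (simp only: exp_add exp_ln[OF pos])
  also have "\<dots> ^ n \<le> exp (l\<^sup>2 / 8) ^ n"
    using assms Hoeffdings_lemma_aux[of l p] by (intro power_mono) auto
  also have "\<dots> = exp (n * l\<^sup>2 / 8)"
    by (simp flip: exp_of_nat_mult)
  finally show ?thesis .
qed


section \<open>Majorant and numerical constants\<close>

text \<open>
  Here \<open>7.92 w\<^sup>2\<close> stands for the bound on the likelihood ratio, and \<open>250/57\<close> is the critical
  point of \<open>0.152 w\<^sup>3 - w\<^sup>2\<close>.
\<close>

lemma cubic_majorant: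
  fixes w :: real
  assumes "0 < w"
  shows "1 - 51 / (792/100 * w\<^sup>2) \<le> 152/1000 * w"
proof -
  have "0 \<le> (w - 250/57)\<^sup>2 * (152/1000 * w + 1/3)"
    using assms by simp
  also have "\<dots> = 152/1000 * w ^ 3 - w\<^sup>2 + (250/57)\<^sup>2 / 3"
    by (simp add: field_simps power2_eq_square power3_eq_cube)
  also have "\<dots> \<le> 152/1000 * w ^ 3 - w\<^sup>2 + 5100/792"
    by (simp add: power2_eq_square)
  also have "\<dots> = w\<^sup>2 * (152/1000 * w - (1 - 51 / (792/100 * w\<^sup>2)))"
    using assms by (simp add: field_simps power2_eq_square power3_eq_cube)
  finally show ?thesis
    using assms by (simp add: zero_le_mult_iff)
qed

text \<open>The exponents are the bound 2.06 at the mean, 1.96 = 2.45 * 0.8, 0.7503125 = 2.45^2 / 8,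
  and the Hoeffding exponent for a deviation of 2 sqrt n.\<close>

lemma exp_numeric_bounds:
  "exp (206/100) \<le> (792/100 :: real)"
  "1000/152 \<le> exp (196/100 :: real)"
  "exp (7503125/10000000) \<le> (214/100 :: real)"
  "exp (-8) \<le> (1/1000 :: real)"
proof -
  have inv: "exp x \<le> 1 / c" if "c \<le> (1 - x / k) ^ k" "0 < c" "x < k" "0 < k"
    for x c :: real and k :: nat
  proof -
    have "c \<le> (1 - x / k) ^ k"
      by (fact that)
    also have "\<dots> \<le> exp (- x / k) ^ k"
      using that exp_ge_add_one_self[of "- x / k"] by (intro power_mono) auto
    also have "\<dots> = exp (- x)"
      using that by (simp flip: exp_of_nat_mult)
    finally show ?thesis
      using that by (simp add: exp_minus field_simps)
  qed
  \<comment> \<open>The margin between exp 2.06 and 7.92 is small, so the exponent is subdivided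
    twice, into 16 * 16 parts.\<close>
  have "exp (103/800) \<le> 1 / (8787/10000 :: real)"
    by (rule inv[of _ _ 16]) (simp_all add: power_divide)
  then have "exp (103/800 :: real) ^ 16 \<le> (10000/8787) ^ 16"
    by (intro power_mono) auto
  also have "\<dots> \<le> 792/100"
    by (simp add: power_divide)
  finally show "exp (206/100) \<le> (792/100 :: real)"
    by (simp flip: exp_of_nat_mult)
  have "exp (7503125/10000000) \<le> 1 / (100/214 :: real)"
    by (rule inv[of _ _ 32]) (simp_all add: power_divide)
  then show "exp (7503125/10000000) \<le> (214/100 :: real)"
    by simp
  have "1000/152 \<le> (1 + 196/3200 :: real) ^ 32"
    by (simp add: power_divide divide_simps)
  also have "\<dots> \<le> exp (196/3200) ^ 32"
    by (intro power_mono exp_ge_add_one_self) auto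
  also have "\<dots> = exp (196/100)"
    by (simp flip: exp_of_nat_mult)
  finally show "1000/152 \<le> exp (196/100 :: real)" .
  have "(1000::real) \<le> (1 + 8/32) ^ 32"
    by (simp add: power_divide)
  also have "\<dots> \<le> exp (8/32) ^ 32"
    by (intro power_mono exp_ge_add_one_self) auto
  also have "\<dots> = exp 8"
    by (simp flip: exp_of_nat_mult)
  finally show "exp (-8) \<le> (1/1000 :: real)"
    by (simp add: exp_minus field_simps)
qed

section \<open>Combining the pointwise bounds\<close>

theorem mainTheorem1:
  fixes n m :: nat and S :: "nat set"
  assumes "n \<ge> 931" and "8 * m \<le> n" and "S \<subseteq> {0..n}"
  shows "measure_pmf.prob (binomial_pmf n (p_mn m n)) S
    \<le> 51 * measure_pmf.prob (map_pmf (\<lambda>k. m + k) (binomial_pmf (n - m) (1/2))) S + 1/3"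
proof -
  define p where "p = p_mn m n"
  define e where "e = sqrt (ln 6 / (2 * real n))"
  define r where "r = sqrt (real n)"
  define P where "P = pmf (binomial_pmf n p)"
  define Q where "Q = pmf (map_pmf (\<lambda>k. m + k) (binomial_pmf (n - m) (1/2)))"
  \<comment> \<open>The rate 2.45 is half of the slope 4.9, so that the likelihood ratio grows like
    the square of this exponential.\<close>
  define h where "h = (\<lambda>k::nat. 152/1000 * exp (245/100 / r * (real k - n * p)))"
  have n: "931 \<le> real n" and m: "0 \<le> real m" "8 * real m \<le> real n"
    using assms by linarith+
  have e: "0 < e" "2 * real n * e\<^sup>2 = ln 6"
    using n by (simp_all add: e_def)
  have p_eq: "p = 1/2 + real m / (2 * real n) + e"
    by (simp add: p_def e_def p_mn_def)
  have r: "305/10 \<le> r" "e * r \<le> 947/1000"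
    using scaled_deviation_bounds[OF n e] by (simp_all add: r_def)
  have rr: "r * r = n"
    by (simp add: r_def)
  have "e \<le> 947/1000 / r"
    using r by (simp add: field_simps)
  also have "\<dots> \<le> 947/1000 / (305/10)"
    using r by (intro frac_le) auto
  finally have "e \<le> 1/10" by simp
  moreover have "real m / (2 * real n) \<le> 1/16"
    using n m by (simp add: field_simps)
  moreover have "0 \<le> real m / (2 * real n)"
    by simp
  ultimately have p: "0 < p" "p < 1"
    unfolding p_eq using e(1) by linarith+
  have h_pos: "0 < h k" for k
    by (simp add: h_def)

  have pointwise: "P k \<le> 51 * Q k + P k * (if real k \<le> n * p - 2 * r then 1 else 0) + P k * h k"
    if k: "k \<in> S" for k
  proof -
    have kn: "k \<le> n" using k assms(3) by auto
    have PQ: "0 \<le> P k" "0 \<le> Q k"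
      by (auto simp: P_def Q_def)
    have Ph: "0 \<le> P k * h k"
      using PQ h_pos[of k] by simp
    have ratio: "P k \<le> Q k * exp (log_ratio n m p k)" if "m < k"
      unfolding P_def Q_def by (rule pmf_binomial_le_shifted) (use that kn p in auto)
    have mean: "log_ratio n m p (n * p) \<le> 206/100"
      by (rule log_ratio_mean_le[OF n m e p_eq p(2)])
    \<comment> \<open>The cases are paid for differently: the indicator covers the far lower tail,
      the factor 51 covers the range up to the mean, \<open>cubic_majorant\<close> the range just
      above it, and beyond that \<open>h k \<ge> 1\<close> is enough.\<close>
    consider "real k \<le> n * p - 2 * r"
      | "n * p - 2 * r < k" "k \<le> n * p"
      | "n * p < k" "k \<le> n * p + 8/10 * r"
      | "n * p + 8/10 * r < k"
      by linarith
    then show ?thesis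
    proof cases
      case 1
      then show ?thesis using PQ Ph by simp
    next
      case 2
      have mk: "real m < real k" and le: "log_ratio n m p k \<le> log_ratio n m p (n * p)"
        using log_ratio_mono_below_mean[OF n m e p_eq p(2), of k] 2 by (auto simp: r_def)
      have "P k \<le> Q k * exp (log_ratio n m p k)"
        using ratio mk by simp
      also have "\<dots> \<le> Q k * exp (206/100)"
        using le mean PQ by (intro mult_left_mono) auto
      also have "\<dots> \<le> Q k * 51"
        using exp_numeric_bounds(1) PQ by (intro mult_left_mono) auto
      finally show ?thesis using Ph PQ by simp
    next
      case 3
      define w where "w = exp (245/100 / r * (real k - n * p))"
      have w: "0 < w" by (simp add: w_def)
      have w2: "w\<^sup>2 = exp (49/10 * (real k - n * p) / r)"
        by (simp add: w_def power2_eq_square flip: exp_add)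
      have "0 \<le> real m / (2 * real n)"
        by simp
      then have "real n * (1/2) < n * p"
        using n e by (intro mult_strict_left_mono) (unfold p_eq, linarith+)
      then have mk: "m < k"
        using 3 m n by linarith
      have "log_ratio n m p k \<le> 206/100 + 49/10 * (real k - n * p) / r"
        using log_ratio_above_mean[OF n m e p_eq p(2), of k] mean 3 by (auto simp: r_def)
      then have "exp (log_ratio n m p k) \<le> exp (206/100) * w\<^sup>2"
        unfolding w2 by (simp flip: exp_add)
      also have "\<dots> \<le> 792/100 * w\<^sup>2"
        using exp_numeric_bounds(1) by (intro mult_right_mono) auto
      finally have "Q k * exp (log_ratio n m p k) \<le> Q k * (792/100 * w\<^sup>2)"
        using PQ by (intro mult_left_mono)
      with ratio[OF mk] have "P k \<le> Q k * (792/100 * w\<^sup>2)"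
        by simp
      then have "P k / (792/100 * w\<^sup>2) \<le> Q k"
        using w by (simp add: divide_le_eq)
      then have "P k - 51 * Q k \<le> P k - 51 * (P k / (792/100 * w\<^sup>2))"
        by simp
      also have "\<dots> = P k * (1 - 51 / (792/100 * w\<^sup>2))"
        by (simp add: right_diff_distrib)
      also have "\<dots> \<le> P k * h k"
        using cubic_majorant[OF w] PQ by (intro mult_left_mono) (auto simp: h_def w_def)
      finally show ?thesis using PQ by simp
    next
      case 4
      \<comment> \<open>The cutoff 0.8 is large enough that \<open>h k\<close> has reached 1 there,
        since 0.152 * exp 1.96 exceeds 1.\<close>
      have "196/100 = 245/100 / r * (8/10 * r)"
        using r by simp
      also have "\<dots> \<le> 245/100 / r * (real k - n * p)"
        using 4 r by (intro mult_left_mono) auto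
      finally have "exp (196/100) \<le> exp (245/100 / r * (real k - n * p))"
        by simp
      with exp_numeric_bounds(2) have "1000/152 \<le> exp (245/100 / r * (real k - n * p))"
        by (rule order_trans)
      then have "1 \<le> h k"
        by (simp add: h_def)
      then have "P k * 1 \<le> P k * h k"
        using PQ by (intro mult_left_mono)
      then show ?thesis using PQ by simp
    qed
  qed

  have fin: "finite S" using assms(3) finite_subset by blast
  have "measure_pmf.prob (binomial_pmf n p) S = (\<Sum>k\<in>S. P k)"
    using fin by (simp add: measure_measure_pmf_finite P_def)
  also have "\<dots> \<le> (\<Sum>k\<in>S. 51 * Q k + P k * (if real k \<le> n * p - 2 * r then 1 else 0) + P k * h k)"
    by (intro sum_mono pointwise)
  also have "\<dots> = 51 * (\<Sum>k\<in>S. Q k) + (\<Sum>k\<in>S. P k * (if real k \<le> n * p - 2 * r then 1 else 0))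
      + (\<Sum>k\<in>S. P k * h k)"
    by (simp add: sum.distrib sum_distrib_left)
  also have "(\<Sum>k\<in>S. Q k) = measure_pmf.prob (map_pmf (\<lambda>k. m + k) (binomial_pmf (n - m) (1/2))) S"
    unfolding Q_def by (rule measure_measure_pmf_finite[OF fin, symmetric])
  also have "(\<Sum>k\<in>S. P k * (if real k \<le> n * p - 2 * r then 1 else 0)) \<le> 1/1000"
  proof -
    interpret binomial_distribution n p
      by unfold_locales (use p in auto)
    have "(\<Sum>k\<in>S. P k * (if real k \<le> n * p - 2 * r then 1 else 0))
        = (\<Sum>k\<in>{k\<in>S. real k \<le> n * p - 2 * r}. P k)"
      using fin by (intro sum.mono_neutral_cong_right) auto
    also have "\<dots> = measure_pmf.prob (binomial_pmf n p) {k\<in>S. real k \<le> n * p - 2 * r}"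
      using fin by (simp add: measure_measure_pmf_finite P_def)
    also have "\<dots> \<le> measure_pmf.prob (binomial_pmf n p) {x. real x \<le> n * p - 2 * r}"
      by (intro measure_pmf.finite_measure_mono) auto
    also have "\<dots> \<le> exp (- 2 * (2 * r)\<^sup>2 / n)"
      using n r by (intro prob_le) auto
    also have "- 2 * (2 * r)\<^sup>2 / n = -8"
      using n rr by (simp add: power2_eq_square)
    finally show ?thesis
      using exp_numeric_bounds(4) by simp
  qed
  also have "(\<Sum>k\<in>S. P k * h k) \<le> 152/1000 * (214/100)"
  proof -
    \<comment> \<open>Positivity of \<open>h\<close> allows the sum to be extended to the full
      expectation.\<close>
    have "(\<Sum>k\<in>S. P k * h k) \<le> (\<Sum>k\<le>n. P k * h k)"
      using assms(3) h_pos by (intro sum_mono2) (auto simp: P_def less_imp_le)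
    also have "\<dots> = 152/1000 *
        measure_pmf.expectation (binomial_pmf n p) (\<lambda>k. exp (245/100 / r * (real k - n * p)))"
      using p by (subst expectation_binomial_pmf') (auto simp: P_def h_def sum_distrib_left mult_ac)
    also have "\<dots> \<le> 152/1000 * exp (n * (245/100 / r)\<^sup>2 / 8)"
      using p r by (intro mult_left_mono binomial_mgf_le) auto
    also have "n * (245/100 / r)\<^sup>2 / 8 = 7503125/10000000"
      using r rr[symmetric] by (simp add: power2_eq_square)
    finally show ?thesis
      using exp_numeric_bounds(3) by simp
  qed
  \<comment> \<open>The two error terms add up to 0.001 + 0.32528, which is below 1/3.\<close>
  finally show ?thesis
    by (simp add: p_def)
qed

end
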